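(* Let $m,N\ge1$ be integers. Every multiset in $\mathcal V(m,N)$ has at most $m^N$ elements (counted with multiplicity).
   Context: $\mathcal V(m,N)$ is the set of all (non-empty, finite) multisets $\{v_1,\dots,v_k\}$ of vectors in $(\mathbb Z/m)^N$ such that $\sum_{i=1}^k v_i=0$ but no proper non-empty submultiset of $\{v_1,\dots,v_k\}$ adds up to $0$. *)

theory Defs
  imports "HOL-Algebra.Algebra" "HOL-Library.Multiset"
begin

(* HOL-Algebra writes groups multiplicatively: the operation of zmod_vec m N is componentwise
   addition mod m, its unit is the zero vector. Elements are functions on {..<N} with values in
   {0..<m} (for m \<ge> 1), extended by undefined outside {..<N}. *)
definition zmod_vec :: "nat \<Rightarrow> nat \<Rightarrow> (nat \<Rightarrow> int) monoid" where
  "zmod_vec m N = product_group {..<N} (\<lambda>_. integer_mod_group m)"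

(* Sum of a multiset in a commutative group: each distinct element contributes as often as its
   multiplicity, as is confirmed by msum_empty and msum_add_mset below. *)
definition msum :: "('a, 'b) monoid_scheme \<Rightarrow> 'a multiset \<Rightarrow> 'a" where
  "msum G M = (\<Otimes>\<^bsub>G\<^esub>v\<in>set_mset M. v [^]\<^bsub>G\<^esub> count M v)"

definition minimal_zero_sum :: "('a, 'b) monoid_scheme \<Rightarrow> 'a multiset set" where
  "minimal_zero_sum G =
     {M. M \<noteq> {#} \<and> set_mset M \<subseteq> carrier G \<and> msum G M = \<one>\<^bsub>G\<^esub> \<and>
         (\<forall>B. B \<subset># M \<and> B \<noteq> {#} \<longrightarrow> msum G B \<noteq> \<one>\<^bsub>G\<^esub>)}"

definition \<V> :: "nat \<Rightarrow> nat \<Rightarrow> (nat \<Rightarrow> int) multiset set" where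
  "\<V> m N = minimal_zero_sum (zmod_vec m N)"

lemma comm_group_zmod_vec: "comm_group (zmod_vec m N)"
proof -
  interpret Z: comm_group "integer_mod_group m" by simp
  have g: "group (zmod_vec m N)"
    unfolding zmod_vec_def by (simp add: Z.is_group)
  show ?thesis
    by (rule group.group_comm_groupI[OF g])
       (auto simp: zmod_vec_def product_group_def PiE_iff add.commute intro!: restrict_ext)
qed

lemma card_carrier_zmod_vec: "m \<ge> 1 \<Longrightarrow> card (carrier (zmod_vec m N)) = m ^ N"
  by (simp add: zmod_vec_def carrier_integer_mod_group card_PiE)

lemma (in comm_monoid) msum_empty: "msum G {#} = \<one>"
  by (simp add: msum_def)

lemma (in comm_monoid) msum_add_mset:
  assumes M: "set_mset M \<subseteq> carrier G" and x: "x \<in> carrier G"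
  shows "msum G (add_mset x M) = x \<otimes> msum G M"
proof -
  let ?S = "insert x (set_mset M)"
  have extend: "msum G M = (\<Otimes>v\<in>?S. v [^] count M v)"
    unfolding msum_def using M x
    by (cases "x \<in># M") (auto simp: insert_absorb not_in_iff intro!: finprod_mono_neutral_cong_left)
  have "msum G (add_mset x M) = (\<Otimes>v\<in>?S. v [^] count (add_mset x M) v)"
    by (simp add: msum_def)
  also have "\<dots> = (\<Otimes>v\<in>?S. (if v = x then x else \<one>) \<otimes> v [^] count M v)"
    using M x by (intro finprod_cong') (auto simp: m_comm)
  also have "\<dots> = (\<Otimes>v\<in>?S. if v = x then x else \<one>) \<otimes> (\<Otimes>v\<in>?S. v [^] count M v)"
    using M x by (intro finprod_multf) auto
  also have "(\<Otimes>v\<in>?S. if v = x then x else \<one>) = x"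
    using finprod_singleton[of x ?S "\<lambda>_. x"] x by (simp add: eq_commute)
  finally show ?thesis by (simp add: extend)
qed

end

theory Submission
  imports Defs
begin

text \<open>
  The bound is the pigeonhole argument for the Davenport constant and holds in every finite
  commutative group \<open>G\<close>. List the elements of a minimal zero-sum multiset as
  \<open>v\<^sub>1, \<dots>, v\<^sub>k\<close> in any order and look at the sums of the \<open>k\<close> prefixes of length
  \<open>0, \<dots>, k - 1\<close>. If two of them, of lengths \<open>i < j\<close>, were equal, the block
  \<open>v\<^bsub>i+1\<^esub>, \<dots>, v\<^sub>j\<close> would have sum zero; it is non-empty, and it is proper because \<open>j < k\<close>,
  so minimality would be violated. Hence the \<open>k\<close> prefix sums are distinct elements of \<open>G\<close> and
  \<open>k \<le> |G|\<close>. For \<open>G = (\<int>/m)\<^sup>N\<close> the order is \<open>m\<^sup>N\<close>.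
\<close>

lemma (in comm_monoid) msum_closed:
  "set_mset M \<subseteq> carrier G \<Longrightarrow> msum G M \<in> carrier G"
  unfolding msum_def by (auto intro!: finprod_closed)

lemma (in comm_monoid) msum_union:
  assumes "set_mset A \<subseteq> carrier G" and "set_mset B \<subseteq> carrier G"
  shows "msum G (A + B) = msum G A \<otimes> msum G B"
  using assms(1)
proof (induction A)
  case empty
  then show ?case using assms(2) by (simp add: msum_empty msum_closed)
next
  case (add x A)
  then show ?case using assms(2) by (simp add: msum_add_mset msum_closed m_assoc)
qed

text \<open>
  Lengths run over \<open>{..<length xs}\<close>: the full prefix is left out because its sum agrees with
  that of the empty one.
\<close>
lemma (in comm_group) inj_on_prefix_sums:
  assumes M: "mset xs \<in> minimal_zero_sum G"
  shows "inj_on (\<lambda>i. msum G (mset (take i xs))) {..<length xs}"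
proof (rule linorder_inj_onI')
  fix i j assume "j \<in> {..<length xs}" and ij: "i < j"
  then have j: "j < length xs" by simp
  define block where "block = mset (drop i (take j xs))"
  have split: "mset (take j xs) = mset (take i xs) + block"
    using ij append_take_drop_id[of i "take j xs"]
    unfolding block_def by (metis mset_append take_take min.absorb1 less_imp_le)
  have whole: "mset xs = mset (take j xs) + mset (drop j xs)"
    by (metis mset_append append_take_drop_id)
  have carr: "set_mset (mset (take i xs)) \<subseteq> carrier G" "set_mset block \<subseteq> carrier G"
    using M whole split by (auto simp: minimal_zero_sum_def)
  have nonempty: "block \<noteq> {#}"
    using ij j by (simp add: block_def)
  have "block \<subseteq># mset xs"
    using whole split by simp
  moreover have "size block \<noteq> size (mset xs)"
    using j ij by (simp add: block_def)
  ultimately have proper: "block \<subset># mset xs"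
    by (auto simp: subset_mset.less_le)
  have nonzero: "msum G block \<noteq> \<one>"
    using M proper nonempty by (auto simp: minimal_zero_sum_def)
  show "msum G (mset (take i xs)) \<noteq> msum G (mset (take j xs))"
  proof
    assume "msum G (mset (take i xs)) = msum G (mset (take j xs))"
    also have "\<dots> = msum G (mset (take i xs)) \<otimes> msum G block"
      using carr by (simp only: split msum_union)
    finally show False
      using nonzero l_cancel_one'[of "msum G (mset (take i xs))" "msum G block"]
        msum_closed carr by blast
  qed
qed

lemma (in comm_group) size_minimal_zero_sum_le_order:
  assumes fin: "finite (carrier G)" and M: "M \<in> minimal_zero_sum G"
  shows "size M \<le> card (carrier G)"
proof -
  obtain xs where xs: "M = mset xs"
    using ex_mset by metis
  let ?p = "\<lambda>i. msum G (mset (take i xs))"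
  have "?p ` {..<length xs} \<subseteq> carrier G"
    using M by (auto simp: xs minimal_zero_sum_def intro!: msum_closed) (meson in_set_takeD subsetD)
  then have "card {..<length xs} \<le> card (carrier G)"
    using inj_on_prefix_sums M fin unfolding xs by (intro card_inj_on_le) auto
  then show ?thesis by (simp add: xs)
qed

theorem proposition9:
  fixes m N :: nat
  assumes "m \<ge> 1" and "N \<ge> 1"
  shows "\<forall>M \<in> \<V> m N. size M \<le> m ^ N"
proof
  fix M assume M: "M \<in> \<V> m N"
  have card: "card (carrier (zmod_vec m N)) = m ^ N"
    using assms(1) by (rule card_carrier_zmod_vec)
  \<comment> \<open>Infinite sets have cardinality 0, so a positive cardinality gives finiteness.\<close>
  then have "finite (carrier (zmod_vec m N))"
    using assms(1) by (intro card_ge_0_finite) simp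
  then show "size M \<le> m ^ N"
    using comm_group.size_minimal_zero_sum_le_order[OF comm_group_zmod_vec] M card
    unfolding \<V>_def by metis
qed

end
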